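(* Let $G$ be a graph of order at least $3$ with property (P). Then, for every graph $H$, the lexicographic product $H[G]$ has property (P).
   Context: Graphs are finite and simple. For a graph $G$ on vertex set $\{1,\dots,n\}$, $S(G)$ is the set of real symmetric $n\times n$ matrices $A$ such that for all $i\ne j$, $A_{ij}\neq 0$ if and only if $ij\in E(G)$ (diagonal entries are unrestricted). $A(i)$ denotes the principal submatrix of $A$ obtained by deleting row and column $i$, and $m_A(0)$ the multiplicity of $0$ as an eigenvalue of $A$. A vertex $i$ is a P-vertex of $A$ if $m_{A(i)}(0)-m_A(0)=1$, and $P_\nu(A)$ is the number of P-vertices of $A$. $G$ has property (P) if there exists a nonsingular $A\in S(G)$ with $P_\nu(A)=n$ (equivalently, a nonsingular $A\in S(G)$ with $\det A(i)=0$ for all $i$, i.e. $A^{-1}$ has zero diagonal). The lexicographic product $H[G]$ is obtained by replacing each vertex of $H$ with a (disjoint) copy of $G$, and joining every vertex of the copy at $u$ to every vertex of the copy at $v$ whenever $uv\in E(H)$. *)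

theory Defs
  imports
    "Graph_Theory.Pair_Digraph"
    "Jordan_Normal_Form.Char_Poly"
begin

text \<open>
  A finite simple graph is a \<^locale>\<open>pair_graph\<close>: each edge is represented by its two
  opposite arcs. Row and column indices of matrices run over \<open>0, \<dots>, n - 1\<close> instead of
  \<open>1, \<dots>, n\<close>.
\<close>

text \<open>
  A graph with an arbitrary vertex set is read as a graph on \<open>{0..<n}\<close> through an
  enumeration \<open>f\<close> of its vertices.
\<close>

definition vertex_enum :: "(nat \<Rightarrow> 'a) \<Rightarrow> 'a pair_pre_digraph \<Rightarrow> bool" where
  "vertex_enum f G \<longleftrightarrow> bij_betw f {0..<card (pverts G)} (pverts G)"

definition graph_matrices :: "(nat \<Rightarrow> 'a) \<Rightarrow> 'a pair_pre_digraph \<Rightarrow> real mat set" where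
  "graph_matrices f G =
     {A \<in> carrier_mat (card (pverts G)) (card (pverts G)).
        transpose_mat A = A \<and>
        (\<forall>i < card (pverts G). \<forall>j < card (pverts G).
           i \<noteq> j \<longrightarrow> (A $$ (i, j) \<noteq> 0 \<longleftrightarrow> (f i, f j) \<in> parcs G))}"

definition eigenvalue_mult :: "real mat \<Rightarrow> real \<Rightarrow> nat" where
  "eigenvalue_mult A x = Polynomial.order x (char_poly A)"

text \<open>The difference is taken in the integers, since it can also be \<open>-1\<close>.\<close>

definition P_vertex :: "real mat \<Rightarrow> nat \<Rightarrow> bool" where
  "P_vertex A i \<longleftrightarrow> i < dim_row A \<and>
     int (eigenvalue_mult (mat_delete A i i) 0) - int (eigenvalue_mult A 0) = 1"

definition P_nu :: "real mat \<Rightarrow> nat" where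
  "P_nu A = card {i. P_vertex A i}"

text \<open>
  Two enumerations of the vertices differ by a permutation of the indices, under which matrix
  patterns, invertibility and the number of P-vertices are invariant; so it does not matter
  which enumeration is used.
\<close>

definition property_P :: "'a pair_pre_digraph \<Rightarrow> bool" where
  "property_P G \<longleftrightarrow>
     (\<exists>f. vertex_enum f G \<and>
        (\<exists>A \<in> graph_matrices f G. invertible_mat A \<and> P_nu A = card (pverts G)))"

text \<open>
  \<open>lex_product H G\<close> is $H[G]$; the vertex \<open>(u, x)\<close> is the vertex \<open>x\<close> of the copy of \<open>G\<close>
  that replaces the vertex \<open>u\<close> of \<open>H\<close>.
\<close>

definition lex_product ::
  "'b pair_pre_digraph \<Rightarrow> 'a pair_pre_digraph \<Rightarrow> ('b \<times> 'a) pair_pre_digraph" where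
  "lex_product H G =
     \<lparr> pverts = pverts H \<times> pverts G,
       parcs = {((u, x), (v, y)) | u x v y.
         u \<in> pverts H \<and> v \<in> pverts H \<and> x \<in> pverts G \<and> y \<in> pverts G \<and>
         ((u, v) \<in> parcs H \<or> u = v \<and> (x, y) \<in> parcs G)} \<rparr>"

lemma pair_graph_lex_product:
  assumes "pair_graph H" and "pair_graph G"
  shows "pair_graph (lex_product H G)"
proof -
  interpret H: pair_graph H by fact
  interpret G: pair_graph G by fact
  let ?L = "lex_product H G"
  have fin: "finite (pverts ?L)"
    by (simp add: lex_product_def H.pair_finite_verts G.pair_finite_verts)
  have sub: "parcs ?L \<subseteq> pverts ?L \<times> pverts ?L"
    by (auto simp: lex_product_def)
  have symH: "(v, u) \<in> parcs H" if "(u, v) \<in> parcs H" for u v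
    using that H.pair_sym_arcs by (auto simp: symmetric_def dest: symD)
  have symG: "(v, u) \<in> parcs G" if "(u, v) \<in> parcs G" for u v
    using that G.pair_sym_arcs by (auto simp: symmetric_def dest: symD)
  have "sym (parcs ?L)"
    by (rule symI) (auto simp: lex_product_def intro: symH symG)
  moreover have "fst e \<noteq> snd e" if "e \<in> parcs ?L" for e
    using that H.pair_no_loops G.pair_no_loops by (fastforce simp: lex_product_def)
  moreover have "finite (parcs ?L)"
    using sub fin finite_subset by blast
  ultimately show ?thesis
    using sub fin by unfold_locales (auto simp: symmetric_def)
qed

end

theory Submission
  imports Defs
begin

text \<open>
  Let \<open>A\<close> be a nonsingular symmetric matrix with inverse \<open>C\<close>. All vertices are P-vertices of \<open>A\<close>
  iff \<open>C\<close> has zero diagonal. If the order is at least 3, the quadratic form of \<open>C\<close> then has at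
  least two monomials, so it vanishes at some vector \<open>w\<close> without zero entries. Let \<open>M\<close> be the
  adjacency matrix of \<open>H\<close> and \<open>z = C w\<close>. The matrix \<open>I \<otimes> A + M \<otimes> w w\<^sup>T\<close> has the pattern of
  \<open>H[G]\<close>, and since \<open>w\<^sup>T z = 0\<close> its inverse is \<open>I \<otimes> C - M \<otimes> z z\<^sup>T\<close>, which has zero diagonal.
\<close>

section \<open>P-vertices and the diagonal of the inverse\<close>

lemma mat_mult_eq_one_iff:
  fixes A B :: "'a :: semiring_1 mat"
  assumes "A \<in> carrier_mat n n" "B \<in> carrier_mat n n"
  shows "A * B = 1\<^sub>m n \<longleftrightarrow>
    (\<forall>i<n. \<forall>j<n. (\<Sum>k<n. A $$ (i, k) * B $$ (k, j)) = (if i = j then 1 else 0))"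
proof -
  have entry: "(A * B) $$ (i, j) = (\<Sum>k<n. A $$ (i, k) * B $$ (k, j))" if "i < n" "j < n" for i j
    using assms that by (auto simp: scalar_prod_def lessThan_atLeast0)
  show ?thesis
  proof
    assume "A * B = 1\<^sub>m n"
    then show "\<forall>i<n. \<forall>j<n. (\<Sum>k<n. A $$ (i, k) * B $$ (k, j)) = (if i = j then 1 else 0)"
      using entry by (metis index_one_mat(1))
  next
    assume "\<forall>i<n. \<forall>j<n. (\<Sum>k<n. A $$ (i, k) * B $$ (k, j)) = (if i = j then 1 else 0)"
    then show "A * B = 1\<^sub>m n"
      using assms by (intro eq_matI) (simp_all add: entry[symmetric] del: index_mult_mat(1))
  qed
qed

lemma invertible_mat_iff:
  fixes A :: "'a :: field mat"
  assumes "A \<in> carrier_mat n n"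
  shows "invertible_mat A \<longleftrightarrow> (\<exists>C \<in> carrier_mat n n. A * C = 1\<^sub>m n)"
proof
  assume "invertible_mat A"
  then obtain C where C: "A * C = 1\<^sub>m (dim_row A)" "C * A = 1\<^sub>m (dim_row C)"
    by (auto simp: invertible_mat_def inverts_mat_def)
  \<comment> \<open>The definition of \<open>invertible_mat\<close> does not fix the shape of the
    inverse; comparing column counts in the two identities does.\<close>
  have "dim_col C = n"
    using arg_cong[OF C(1), of dim_col] assms by simp
  moreover have "dim_row C = n"
    using arg_cong[OF C(2), of dim_col] assms by simp
  ultimately show "\<exists>C \<in> carrier_mat n n. A * C = 1\<^sub>m n"
    using C(1) assms by auto
next
  assume "\<exists>C \<in> carrier_mat n n. A * C = 1\<^sub>m n"
  then obtain C where C: "C \<in> carrier_mat n n" "A * C = 1\<^sub>m n" by blast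
  then have "C * A = 1\<^sub>m n"
    using mat_mult_left_right_inverse assms by blast
  then show "invertible_mat A"
    using C assms by (auto simp: invertible_mat_def inverts_mat_def)
qed

lemma char_poly_matrix_mat_delete:
  assumes "A \<in> carrier_mat n n" "i < n"
  shows "char_poly_matrix (mat_delete A i i) = mat_delete (char_poly_matrix A) i i"
  using assms by (intro eq_matI) (auto simp: char_poly_matrix_def mat_delete_def)

text \<open>A root at 0 would give a nonzero kernel vector \<open>v\<close> of \<open>A\<close>, but
  \<open>v = C (A v) = 0\<close>.\<close>

lemma char_poly_at_zero_ne_zero:
  fixes A :: "'a :: field mat"
  assumes A: "A \<in> carrier_mat n n" and C: "C \<in> carrier_mat n n" and AC: "A * C = 1\<^sub>m n"
  shows "poly (char_poly A) 0 \<noteq> 0"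
proof
  assume "poly (char_poly A) 0 = 0"
  then obtain v where v: "v \<in> carrier_vec n" "v \<noteq> 0\<^sub>v n" "A *\<^sub>v v = 0 \<cdot>\<^sub>v v"
    using eigenvalue_root_char_poly[OF A, of 0] A by (auto simp: eigenvalue_def eigenvector_def)
  have "v = (C * A) *\<^sub>v v"
    using mat_mult_left_right_inverse[OF A C AC] v(1) by simp
  also have "\<dots> = C *\<^sub>v (0 \<cdot>\<^sub>v v)"
    using assoc_mult_mat_vec[OF C A v(1)] v(3) by simp
  also have "\<dots> = 0\<^sub>v n"
    using C v(1) by (auto simp: scalar_prod_def)
  finally show False using v(2) by simp
qed

text \<open>If the square of the linear factor divided \<open>p\<close>, the product rule would
  leave one such factor in \<open>pderiv p\<close>.\<close>

lemma order_eq_1_of_simple_root: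
  fixes p :: "'a :: field_char_0 poly"
  assumes "poly p a = 0" "poly (pderiv p) a \<noteq> 0"
  shows "Polynomial.order a p = 1"
proof -
  have "p \<noteq> 0" using assms by auto
  then have "Polynomial.order a p \<noteq> 0"
    using assms(1) by (simp add: order_root)
  moreover have "\<not> Polynomial.order a p \<ge> 2"
  proof
    assume "Polynomial.order a p \<ge> 2"
    then have "[:- a, 1:] ^ 2 dvd p"
      using order_1 le_imp_power_dvd dvd_trans by blast
    then obtain q where "p = [:- a, 1:] ^ 2 * q" by blast
    then have "poly (pderiv p) a = 0"
      by (simp only: power2_eq_square mult.assoc pderiv_mult poly_add poly_mult) simp
    with assms(2) show False by simp
  qed
  ultimately show ?thesis by linarith
qed

text \<open>
  The \<open>i\<close>-th column \<open>V\<close> of the adjugate of \<open>x I - A\<close> satisfies \<open>(x I - A) V = \<chi> e\<^sub>i\<close>, where \<open>\<chi>\<close> is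
  the characteristic polynomial, and \<open>V\<^sub>i\<close> is the characteristic polynomial of \<open>A(i)\<close>. At \<open>x = 0\<close>
  this yields \<open>V\<^sub>i(0) = - \<chi>(0) C\<^sub>i\<^sub>i\<close>; its derivative at \<open>0\<close>, paired with \<open>V(0)\<close>, yields
  \<open>\<bar>V(0)\<bar>\<^sup>2 + \<chi>(0) V\<^sub>i'(0) = \<chi>'(0) V\<^sub>i(0)\<close>, so that \<open>0\<close> is at most a simple root of \<open>V\<^sub>i\<close>.
\<close>

lemma P_vertex_iff_inverse_diag:
  assumes A: "A \<in> carrier_mat n n" and sym: "transpose_mat A = A"
    and C: "C \<in> carrier_mat n n" and AC: "A * C = 1\<^sub>m n" and i: "i < n"
  shows "P_vertex A i \<longleftrightarrow> C $$ (i, i) = 0"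
proof -
  define X where "X = char_poly_matrix A"
  define V where "V k = adj_mat X $$ (k, i)" for k
  define \<chi> where "\<chi> = char_poly A"
  have X: "X \<in> carrier_mat n n" using A by (simp add: X_def)
  have adj: "(\<Sum>j<n. X $$ (k, j) * V j) = (if k = i then \<chi> else 0)" if k: "k < n" for k
  proof -
    have "(X * adj_mat X) $$ (k, i) = (\<Sum>j<n. X $$ (k, j) * V j)"
      using X adj_mat(1)[OF X] k i by (auto simp: scalar_prod_def V_def lessThan_atLeast0)
    then show ?thesis
      using adj_mat(2)[OF X] k i by (auto simp: \<chi>_def char_poly_def X_def[symmetric])
  qed
  \<comment> \<open>Separating x from the constant matrix \<open>A\<close> leaves an identity
    between polynomials that can be evaluated and differentiated at 0.\<close>
  have column: "[:0, 1:] * V k - (\<Sum>j<n. Polynomial.smult (A $$ (k, j)) (V j)) = (if k = i then \<chi> else 0)"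
    if k: "k < n" for k
  proof -
    have "(\<Sum>j<n. X $$ (k, j) * V j)
        = (\<Sum>j<n. (if k = j then [:0, 1:] * V j else 0) - Polynomial.smult (A $$ (k, j)) (V j))"
      using k A by (intro sum.cong) (auto simp: X_def char_poly_matrix_def algebra_simps)
    also have "\<dots> = [:0, 1:] * V k - (\<Sum>j<n. Polynomial.smult (A $$ (k, j)) (V j))"
      using k by (simp add: sum_subtractf)
    finally show ?thesis using adj[OF k] by simp
  qed
  define v where "v k = poly (V k) 0" for k
  define v' where "v' k = poly (pderiv (V k)) 0" for k
  define x0 where "x0 = poly \<chi> 0"
  define x1 where "x1 = poly (pderiv \<chi>) 0"
  have at_0: "(\<Sum>j<n. A $$ (k, j) * v j) = (if k = i then - x0 else 0)" if "k < n" for k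
    using arg_cong[OF column[OF that], of "\<lambda>p. poly p 0"]
    by (auto simp: v_def x0_def poly_sum split: if_splits)
  have deriv_at_0: "v k - (\<Sum>j<n. A $$ (k, j) * v' j) = (if k = i then x1 else 0)" if "k < n" for k
  proof -
    have "pderiv (\<Sum>j<n. Polynomial.smult (A $$ (k, j)) (V j))
        = (\<Sum>j<n. Polynomial.smult (A $$ (k, j)) (pderiv (V j)))"
      using higher_pderiv_sum[of 1 "\<lambda>j. Polynomial.smult (A $$ (k, j)) (V j)" "{..<n}"]
      by (simp add: pderiv_smult)
    then show ?thesis
      using arg_cong[OF column[OF that], of "\<lambda>p. poly (pderiv p) 0"]
      by (auto simp: v_def v'_def x1_def poly_sum pderiv_diff pderiv_mult pderiv_pCons
          split: if_splits)
  qed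
  have x0: "x0 \<noteq> 0"
    unfolding x0_def \<chi>_def by (rule char_poly_at_zero_ne_zero[OF A C AC])
  have A_sym: "A $$ (j, k) = A $$ (k, j)" if "j < n" "k < n" for j k
    using that A arg_cong[OF sym, of "\<lambda>B. B $$ (j, k)"] by simp
  have v_i: "v i = - x0 * C $$ (i, i)"
  proof -
    have "C * A = 1\<^sub>m n" by (rule mat_mult_left_right_inverse[OF A C AC])
    then have CA: "(\<Sum>k<n. C $$ (i, k) * A $$ (k, j)) = (if i = j then 1 else 0)" if "j < n" for j
      using mat_mult_eq_one_iff[OF C A] i that by blast
    have "v i = (\<Sum>j<n. (if i = j then 1 else 0) * v j)"
      using i by (simp add: if_distrib[of "\<lambda>x. x * _"] cong: if_cong)
    also have "\<dots> = (\<Sum>j<n. (\<Sum>k<n. C $$ (i, k) * A $$ (k, j)) * v j)"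
      using CA by (intro sum.cong) auto
    also have "\<dots> = (\<Sum>k<n. C $$ (i, k) * (\<Sum>j<n. A $$ (k, j) * v j))"
      unfolding sum_distrib_left sum_distrib_right mult.assoc by (rule sum.swap)
    also have "\<dots> = (\<Sum>k<n. if k = i then - x0 * C $$ (i, k) else 0)"
      using at_0 by (intro sum.cong) auto
    also have "\<dots> = - x0 * C $$ (i, i)"
      using i by simp
    finally show ?thesis .
  qed
  \<comment> \<open>Pair \<open>deriv_at_0\<close> with \<open>v\<close>. Symmetry moves
    \<open>A\<close> from \<open>v'\<close> onto \<open>v\<close>, where \<open>at_0\<close> leaves
    only the entry at \<open>i\<close>.\<close>
  have pairing: "(\<Sum>k<n. (v k)\<^sup>2) + x0 * v' i = x1 * v i"
  proof -
    have "(\<Sum>k<n. v k * (\<Sum>j<n. A $$ (k, j) * v' j)) = (\<Sum>j<n. \<Sum>k<n. v k * (A $$ (k, j) * v' j))"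
      unfolding sum_distrib_left by (rule sum.swap)
    also have "\<dots> = (\<Sum>j<n. v' j * (\<Sum>k<n. A $$ (j, k) * v k))"
      unfolding sum_distrib_left by (intro sum.cong) (auto simp: A_sym)
    also have "\<dots> = (\<Sum>j<n. if j = i then - x0 * v' j else 0)"
      using at_0 by (intro sum.cong) auto
    also have "\<dots> = - x0 * v' i"
      using i by simp
    finally have *: "(\<Sum>k<n. v k * (\<Sum>j<n. A $$ (k, j) * v' j)) = - x0 * v' i" .
    have "(\<Sum>k<n. v k * (v k - (\<Sum>j<n. A $$ (k, j) * v' j))) = (\<Sum>k<n. if k = i then x1 * v k else 0)"
      using deriv_at_0 by (intro sum.cong) auto
    then show ?thesis
      using * i by (simp add: right_diff_distrib sum_subtractf power2_eq_square)
  qed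
  \<comment> \<open>If both vanished, \<open>pairing\<close> would make a sum of real squares zero,
    so \<open>v = 0\<close>; but row \<open>i\<close> of \<open>at_0\<close> equals
    \<open>- x0\<close>, which is nonzero.\<close>
  have simple: "v' i \<noteq> 0" if "v i = 0"
  proof
    assume "v' i = 0"
    then have "(\<Sum>k<n. (v k)\<^sup>2) = 0"
      using pairing that by simp
    then have "\<forall>k<n. v k = 0"
      by (subst (asm) sum_nonneg_eq_0_iff) auto
    then show False
      using at_0[OF i] x0 by simp
  qed
  have "char_poly (mat_delete A i i) = det (mat_delete X i i)"
    by (simp add: char_poly_def char_poly_matrix_mat_delete[OF A i] X_def)
  also have "\<dots> = V i"
    using X i by (auto simp: V_def adj_mat_def cofactor_def)
  finally have "char_poly (mat_delete A i i) = V i" .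
  \<comment> \<open>Since \<open>x0\<close> is nonzero, 0 has multiplicity 0 in \<open>A\<close>, so
    a P-vertex means multiplicity exactly 1 in the submatrix.\<close>
  then have "P_vertex A i \<longleftrightarrow> Polynomial.order 0 (V i) = 1"
    using A i order_0I[OF x0[unfolded x0_def]]
    by (auto simp: P_vertex_def eigenvalue_mult_def \<chi>_def)
  also have "\<dots> \<longleftrightarrow> v i = 0"
  proof
    assume "Polynomial.order 0 (V i) = 1"
    then show "v i = 0"
      by (metis order_0I v_def zero_neq_one)
  next
    assume "v i = 0"
    then show "Polynomial.order 0 (V i) = 1"
      using simple order_eq_1_of_simple_root[of "V i" 0] by (simp add: v_def v'_def)
  qed
  finally show ?thesis
    using v_i x0 by simp
qed

lemma P_nu_eq_dim_iff:
  assumes A: "A \<in> carrier_mat n n" and "transpose_mat A = A"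
    and "C \<in> carrier_mat n n" and "A * C = 1\<^sub>m n"
  shows "P_nu A = n \<longleftrightarrow> (\<forall>i<n. C $$ (i, i) = 0)"
proof -
  have sub: "{i. P_vertex A i} \<subseteq> {..<n}"
    using A by (auto simp: P_vertex_def)
  then have "P_nu A = n \<longleftrightarrow> {i. P_vertex A i} = {..<n}"
    unfolding P_nu_def by (metis card_lessThan card_subset_eq finite_lessThan)
  also have "\<dots> \<longleftrightarrow> (\<forall>i<n. P_vertex A i)"
    using sub by auto
  finally show ?thesis
    using P_vertex_iff_inverse_diag[OF assms] by simp
qed

text \<open>This replaces multiplicities by a certificate: a matrix of the right pattern together
  with a right inverse of zero diagonal. It serves both to use the property for G and to establish
  it for H[G].\<close>

lemma property_P_iff:
  "property_P G \<longleftrightarrow> (\<exists>f. vertex_enum f G \<and> (\<exists>A \<in> graph_matrices f G.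
     \<exists>C \<in> carrier_mat (card (pverts G)) (card (pverts G)).
       A * C = 1\<^sub>m (card (pverts G)) \<and> (\<forall>i < card (pverts G). C $$ (i, i) = 0)))"
proof -
  have "invertible_mat A \<and> P_nu A = card (pverts G) \<longleftrightarrow>
      (\<exists>C \<in> carrier_mat (card (pverts G)) (card (pverts G)).
         A * C = 1\<^sub>m (card (pverts G)) \<and> (\<forall>i < card (pverts G). C $$ (i, i) = 0))"
    if "A \<in> graph_matrices f G" for A f
  proof -
    have A: "A \<in> carrier_mat (card (pverts G)) (card (pverts G))" "transpose_mat A = A"
      using that by (auto simp: graph_matrices_def)
    show ?thesis
      using invertible_mat_iff[OF A(1)] P_nu_eq_dim_iff[OF A] by blast
  qed
  then show ?thesis
    unfolding property_P_def by blast
qed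

section \<open>Isotropic vectors without zero entries\<close>

text \<open>A stand-in for multivariate polynomials: genericity arguments only need that the
  restriction to each line is a univariate polynomial.\<close>

definition line_polynomial :: "(('i \<Rightarrow> real) \<Rightarrow> real) \<Rightarrow> bool" where
  "line_polynomial f \<longleftrightarrow> (\<forall>a b. \<exists>p. \<forall>t. f (\<lambda>i. a i + t * b i) = poly p t)"

lemma line_polynomial_const: "line_polynomial (\<lambda>w. c)"
  unfolding line_polynomial_def by (metis poly_const_conv)

lemma line_polynomial_coord: "line_polynomial (\<lambda>w. w i)"
proof -
  have "a i + t * b i = poly [:a i, b i:] t" for a b :: "'a \<Rightarrow> real" and t
    by simp
  then show ?thesis
    unfolding line_polynomial_def by blast
qed

lemma line_polynomial_add:
  assumes "line_polynomial f" "line_polynomial g"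
  shows "line_polynomial (\<lambda>w. f w + g w)"
  using assms unfolding line_polynomial_def by (metis poly_add)

lemma line_polynomial_mult:
  assumes "line_polynomial f" "line_polynomial g"
  shows "line_polynomial (\<lambda>w. f w * g w)"
  using assms unfolding line_polynomial_def by (metis poly_mult)

lemma line_polynomial_sum:
  assumes "\<And>i. i \<in> S \<Longrightarrow> line_polynomial (f i)"
  shows "line_polynomial (\<lambda>w. \<Sum>i\<in>S. f i w)"
  using assms
  by (induction S rule: infinite_finite_induct)
    (simp_all add: line_polynomial_const line_polynomial_add)

lemma line_polynomial_prod:
  assumes "\<And>i. i \<in> S \<Longrightarrow> line_polynomial (f i)"
  shows "line_polynomial (\<lambda>w. \<Prod>i\<in>S. f i w)"
  using assms
  by (induction S rule: infinite_finite_induct)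
    (simp_all add: line_polynomial_const line_polynomial_mult)

text \<open>On the line through \<open>a\<close> (t = 0) and \<open>b\<close> (t = 1) both
  restrictions are nonzero polynomials, so their product is nonzero and has a non-root t.\<close>

lemma line_polynomial_common_nonzero:
  assumes "line_polynomial f" "line_polynomial g" "f a \<noteq> 0" "g b \<noteq> 0"
  obtains w where "f w \<noteq> 0" "g w \<noteq> 0"
proof -
  let ?l = "\<lambda>t i. a i + t * (b i - a i)"
  obtain p q where p: "\<And>t. f (?l t) = poly p t" and q: "\<And>t. g (?l t) = poly q t"
    using assms(1,2) unfolding line_polynomial_def by metis
  have "poly p 0 \<noteq> 0" "poly q 1 \<noteq> 0"
    using assms(3,4) p[of 0] q[of 1] by simp_all
  then have "p * q \<noteq> 0" by auto
  then obtain t where "poly (p * q) t \<noteq> 0"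
    using poly_all_0_iff_0 by blast
  then show ?thesis
    using p q by (intro that[of "?l t"]) auto
qed

text \<open>On two indices the form is a nonzero multiple of \<open>w p * w q\<close> and has no
  such zero. A third index \<open>b\<close> helps: as \<open>c b b = 0\<close>, the form is affine
  in \<open>w b\<close>. Its slope is not identically zero because row \<open>b\<close> is nonzero,
  nor is its constant term because of the pair \<open>p\<close>, \<open>q\<close>.\<close>

lemma exists_isotropic_nowhere_zero:
  fixes c :: "'i \<Rightarrow> 'i \<Rightarrow> real"
  assumes S: "finite S" "card S \<ge> 3"
    and sym: "\<And>i j. i \<in> S \<Longrightarrow> j \<in> S \<Longrightarrow> c i j = c j i"
    and diag: "\<And>i. i \<in> S \<Longrightarrow> c i i = 0"
    and row: "\<And>i. i \<in> S \<Longrightarrow> \<exists>j\<in>S. c i j \<noteq> 0"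
  obtains w where "\<forall>i\<in>S. w i \<noteq> 0" "(\<Sum>i\<in>S. \<Sum>j\<in>S. c i j * w i * w j) = 0"
proof -
  obtain p where p: "p \<in> S" using S by fastforce
  obtain q where q: "q \<in> S" "c p q \<noteq> 0" using row p by blast
  have pq: "p \<noteq> q" using diag p q by metis
  have "\<not> S \<subseteq> {p, q}"
    using S card_mono[of "{p, q}" S] pq by auto
  then obtain b where b: "b \<in> S" "b \<noteq> p" "b \<noteq> q" by blast
  obtain r where r: "r \<in> S" "c b r \<noteq> 0" using row b by blast
  have br: "r \<noteq> b" using diag b r by metis
  define T where "T = S - {b}"
  have T: "finite T" "p \<in> T" "q \<in> T" "r \<in> T" "b \<notin> T" "S = insert b T"
    using S p q b r br by (auto simp: T_def)
  txt \<open>The form is \<open>R + 2 w\<^sub>b L\<close> with \<open>L\<close> and \<open>R\<close> independent of \<open>w\<^sub>b\<close>; solve it for \<open>w\<^sub>b\<close>.\<close>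
  define L where "L w = (\<Sum>j\<in>T. c b j * w j)" for w
  define R where "R w = (\<Sum>i\<in>T. \<Sum>j\<in>T. c i j * w i * w j)" for w
  \<comment> \<open>Three quantities must be nonzero at once: \<open>L\<close> to divide by it,
    \<open>R\<close> to make the solved entry at \<open>b\<close> nonzero, and \<open>N\<close> for
    the entries in \<open>T\<close>.\<close>
  define N where "N w = (\<Prod>i\<in>T. w i)" for w :: "'i \<Rightarrow> real"
  have lp: "line_polynomial L" "line_polynomial R" "line_polynomial N"
    unfolding L_def R_def N_def
    by (rule line_polynomial_sum line_polynomial_prod line_polynomial_coord
        line_polynomial_mult[OF line_polynomial_const line_polynomial_coord]
        line_polynomial_mult[OF
          line_polynomial_mult[OF line_polynomial_const line_polynomial_coord] line_polynomial_coord])+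
  \<comment> \<open>Test vectors showing that \<open>L\<close> and \<open>R\<close> do not vanish
    identically: the unit vector at \<open>r\<close> picks out \<open>c b r\<close>; the sum of
    those at \<open>p\<close> and \<open>q\<close> picks out \<open>2 * c p q\<close>, the diagonal
    terms being zero.\<close>
  have "L (\<lambda>j. if j = r then 1 else 0) = c b r"
    using T by (simp add: L_def if_distrib[of "\<lambda>x. _ * x"] cong: if_cong)
  moreover have "R (\<lambda>j. (if j = p then 1 else 0) + (if j = q then 1 else 0))
      = c p p + c p q + (c q p + c q q)"
    using T by (simp add: R_def if_distrib[of "\<lambda>x. _ * x"] if_distrib[of "\<lambda>x. x * _"]
        distrib_left distrib_right sum.distrib cong: if_cong)
  then have "R (\<lambda>j. (if j = p then 1 else 0) + (if j = q then 1 else 0)) = 2 * c p q"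
    using sym[of p q] diag p q by simp
  ultimately obtain u where u: "L u * R u \<noteq> 0"
    using line_polynomial_common_nonzero[OF lp(1,2)] r q by (metis mult_eq_0_iff zero_neq_numeral)
  have N1: "N (\<lambda>j. 1) \<noteq> 0" by (simp add: N_def)
  obtain w where w: "L w * R w \<noteq> 0" "N w \<noteq> 0"
    using line_polynomial_common_nonzero[of "\<lambda>w. L w * R w" N u "\<lambda>j. 1"]
      line_polynomial_mult[OF lp(1,2)] lp(3) u N1 by blast
  define w' where "w' = w(b := - R w / (2 * L w))"
  have w'_T: "w' i = w i" if "i \<in> T" for i
    using that T(5) by (auto simp: w'_def)
  have "\<forall>i\<in>S. w' i \<noteq> 0"
    using w T by (auto simp: w'_def N_def)
  moreover have "(\<Sum>i\<in>S. \<Sum>j\<in>S. c i j * w' i * w' j) = 0"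
  proof -
    have 1: "(\<Sum>j\<in>T. c b j * w' b * w' j) = w' b * L w"
      unfolding L_def sum_distrib_left by (intro sum.cong) (auto simp: w'_T)
    have 2: "(\<Sum>i\<in>T. c i b * w' i * w' b) = w' b * L w"
      unfolding L_def sum_distrib_left using sym T by (intro sum.cong) (auto simp: w'_T)
    have 3: "(\<Sum>i\<in>T. \<Sum>j\<in>T. c i j * w' i * w' j) = R w"
      unfolding R_def by (intro sum.cong) (auto simp: w'_T)
    have "(\<Sum>i\<in>S. \<Sum>j\<in>S. c i j * w' i * w' j) = 2 * (w' b * L w) + R w"
      using T(1,5) diag[OF b(1)] 1 2 3 unfolding T(6) by (simp add: sum.distrib)
    also have "\<dots> = 0"
      using w by (simp add: w'_def)
    finally show ?thesis .
  qed
  ultimately show ?thesis using that by blast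
qed

section \<open>The lexicographic product\<close>

lemma mod_less_of_less_mult: "(k :: nat) < m * n \<Longrightarrow> k mod n < n"
  by (cases n) auto

lemma bij_betw_div_mod:
  "bij_betw (\<lambda>k :: nat. (k div n, k mod n)) {..<m * n} ({..<m} \<times> {..<n})"
proof (rule bij_betwI[where g = "\<lambda>(u, x). u * n + x"])
  show "(\<lambda>k. (k div n, k mod n)) \<in> {..<m * n} \<rightarrow> {..<m} \<times> {..<n}"
    by (auto simp: less_mult_imp_div_less mod_less_of_less_mult)
  have "u * n + x < m * n" if "u < m" "x < n" for u x
    using that mult_le_mono1[of "Suc u" m n] by simp
  then show "(\<lambda>(u, x). u * n + x) \<in> {..<m} \<times> {..<n} \<rightarrow> {..<m * n}"
    by auto
qed auto

lemma sum_div_mod: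
  "(\<Sum>k<m * n. g (k div n) (k mod n)) = (\<Sum>u<m. \<Sum>x<n. g u (x :: nat))"
  using sum.reindex_bij_betw[OF bij_betw_div_mod, of "\<lambda>(u, x). g u x" n m]
  by (simp add: sum.cartesian_product)

lemma vertex_enum_lex_product:
  assumes "vertex_enum g H" "vertex_enum f G"
  shows "vertex_enum (\<lambda>k. (g (k div card (pverts G)), f (k mod card (pverts G)))) (lex_product H G)"
proof -
  have "bij_betw (map_prod g f \<circ> (\<lambda>k. (k div card (pverts G), k mod card (pverts G))))
      {..<card (pverts H) * card (pverts G)} (pverts H \<times> pverts G)"
    using assms
    by (intro bij_betw_trans[OF bij_betw_div_mod] bij_betw_map_prod)
      (simp_all add: vertex_enum_def lessThan_atLeast0)
  then show ?thesis
    by (simp add: vertex_enum_def lex_product_def lessThan_atLeast0 card_cartesian_product comp_def)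
qed

text \<open>Entrywise expansion of \<open>(I (x) A + M (x) w w^T) (I (x) C - M (x) z z^T)\<close>,
  with \<open>(x)\<close> the Kronecker product: \<open>A C = I\<close> gives the identity, the
  cross terms are \<open>- M (x) w z^T\<close> and \<open>+ M (x) w z^T\<close>, and the
  \<open>M^2\<close> term carries the factor \<open>w^T z = 0\<close>.\<close>

lemma sum_kronecker_block_product:
  fixes A C :: "nat \<Rightarrow> nat \<Rightarrow> 'a :: comm_ring_1" and M :: "nat \<Rightarrow> nat \<Rightarrow> 'a"
  assumes AC: "\<And>x y. x < n \<Longrightarrow> y < n \<Longrightarrow> (\<Sum>a<n. A x a * C a y) = (if x = y then 1 else 0)"
    and Az: "\<And>x. x < n \<Longrightarrow> (\<Sum>a<n. A x a * z a) = w x"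
    and wC: "\<And>y. y < n \<Longrightarrow> (\<Sum>a<n. w a * C a y) = z y"
    and wz: "(\<Sum>a<n. w a * z a) = 0"
    and "u < m" "v < m" "x < n" "y < n"
  shows "(\<Sum>s<m. \<Sum>a<n. ((if u = s then A x a else 0) + M u s * w x * w a) *
      ((if s = v then C a y else 0) - M s v * z a * z y)) = (if u = v \<and> x = y then 1 else 0)"
proof -
  \<comment> \<open>The two cross terms sit at different blocks, \<open>s = u\<close> and
    \<open>s = v\<close>, so they cancel only after summation over \<open>s\<close>.\<close>
  have block: "(\<Sum>a<n. ((if u = s then A x a else 0) + M u s * w x * w a) *
      ((if s = v then C a y else 0) - M s v * z a * z y))
    = (if s = u then (if u = v \<and> x = y then 1 else 0) - M u v * w x * z y else 0)
      + (if s = v then M u v * w x * z y else 0)" for s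
  proof -
    have "(\<Sum>a<n. ((if u = s then A x a else 0) + M u s * w x * w a) *
        ((if s = v then C a y else 0) - M s v * z a * z y))
      = (\<Sum>a<n. (if u = s \<and> s = v then 1 else 0) * (A x a * C a y)
          - (if u = s then M s v * z y else 0) * (A x a * z a)
          + (if s = v then M u s * w x else 0) * (w a * C a y)
          - M u s * w x * M s v * z y * (w a * z a))"
      by (intro sum.cong) (auto simp: algebra_simps)
    also have "\<dots> = (if u = s \<and> s = v then 1 else 0) * (\<Sum>a<n. A x a * C a y)
          - (if u = s then M s v * z y else 0) * (\<Sum>a<n. A x a * z a)
          + (if s = v then M u s * w x else 0) * (\<Sum>a<n. w a * C a y)
          - M u s * w x * M s v * z y * (\<Sum>a<n. w a * z a)"
      by (simp only: sum_subtractf sum.distrib sum_distrib_left)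
    also have "\<dots> = (if s = u then (if u = v \<and> x = y then 1 else 0) - M u v * w x * z y else 0)
      + (if s = v then M u v * w x * z y else 0)"
      using assms by (auto simp: algebra_simps)
    finally show ?thesis .
  qed
  show ?thesis
    unfolding block sum.distrib using assms(5,6) by simp
qed

theorem corollary4p7:
  fixes G :: "'a pair_pre_digraph" and H :: "'b pair_pre_digraph"
  assumes "pair_graph G"
    and "card (pverts G) \<ge> 3"
    and "property_P G"
    and "pair_graph H"
  shows "property_P (lex_product H G)"
proof -
  interpret H: pair_graph H by fact
  interpret G: pair_graph G by fact
  define n where "n = card (pverts G)"
  define m where "m = card (pverts H)"
  let ?L = "lex_product H G"
  have card_L: "card (pverts ?L) = m * n"
    by (simp add: lex_product_def m_def n_def card_cartesian_product)
  obtain f A C where f: "vertex_enum f G" and A_G: "A \<in> graph_matrices f G"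
    and C: "C \<in> carrier_mat n n" and AC: "A * C = 1\<^sub>m n" and C_diag: "\<forall>i<n. C $$ (i, i) = 0"
    using assms(3) unfolding property_P_iff n_def[symmetric] by blast
  have A: "A \<in> carrier_mat n n" and A_sym: "transpose_mat A = A"
    and A_edge: "\<And>i j. i < n \<Longrightarrow> j < n \<Longrightarrow> i \<noteq> j \<Longrightarrow> A $$ (i, j) \<noteq> 0 \<longleftrightarrow> (f i, f j) \<in> parcs G"
    using A_G by (auto simp: graph_matrices_def n_def)
  obtain g where g: "vertex_enum g H"
    using ex_bij_betw_nat_finite[OF H.pair_finite_verts] by (auto simp: vertex_enum_def)

  \<comment> \<open>Symmetry of the inverse and its isotropic vector\<close>
  have CA: "C * A = 1\<^sub>m n" by (rule mat_mult_left_right_inverse[OF A C AC])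
  have C_sym: "transpose_mat C = C"
  proof -
    have "transpose_mat C * A = 1\<^sub>m n"
      using transpose_mult[OF A C] AC A_sym by simp
    then have "transpose_mat C * (A * C) = C"
      using A C by (subst assoc_mult_mat[symmetric, of _ n n _ n _ n]) auto
    then show ?thesis using AC C by simp
  qed
  have A_sym': "A $$ (i, j) = A $$ (j, i)" if "i < n" "j < n" for i j
    using that A arg_cong[OF A_sym, of "\<lambda>B. B $$ (i, j)"] by simp
  have C_sym': "C $$ (i, j) = C $$ (j, i)" if "i < n" "j < n" for i j
    using that C arg_cong[OF C_sym, of "\<lambda>B. B $$ (i, j)"] by simp
  have AC': "(\<Sum>k<n. A $$ (i, k) * C $$ (k, j)) = (if i = j then 1 else 0)" if "i < n" "j < n" for i j
    using mat_mult_eq_one_iff[OF A C] AC that by blast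

  \<comment> \<open>A zero row of \<open>C\<close> is by symmetry a zero column, which contradicts
    the diagonal entry 1 of \<open>A * C\<close>.\<close>
  have row: "\<exists>j\<in>{..<n}. C $$ (i, j) \<noteq> 0" if "i \<in> {..<n}" for i
  proof (rule ccontr)
    assume "\<not> ?thesis"
    then have "(\<Sum>k<n. A $$ (i, k) * C $$ (k, i)) = 0"
      using that C_sym' by (intro sum.neutral) auto
    with AC'[of i i] that show False by simp
  qed
  obtain w where w: "\<forall>i\<in>{..<n}. w i \<noteq> 0"
    and iso: "(\<Sum>i<n. \<Sum>j<n. C $$ (i, j) * w i * w j) = 0"
    by (rule exists_isotropic_nowhere_zero[of "{..<n}" "\<lambda>i j. C $$ (i, j)"])
      (use assms(2) C_sym' C_diag row in \<open>auto simp: n_def\<close>)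
  define z where "z i = (\<Sum>j<n. C $$ (i, j) * w j)" for i
  have Az: "(\<Sum>a<n. A $$ (x, a) * z a) = w x" if x: "x < n" for x
  proof -
    have "(\<Sum>a<n. A $$ (x, a) * z a) = (\<Sum>j<n. (\<Sum>a<n. A $$ (x, a) * C $$ (a, j)) * w j)"
      unfolding z_def sum_distrib_left sum_distrib_right mult.assoc by (rule sum.swap)
    also have "\<dots> = (\<Sum>j<n. if x = j then w j else 0)"
      using AC' x by (intro sum.cong) auto
    finally show ?thesis using x by simp
  qed
  have wC: "(\<Sum>a<n. w a * C $$ (a, y)) = z y" if "y < n" for y
    unfolding z_def using that C_sym' by (intro sum.cong) auto
  \<comment> \<open>This is the isotropy of \<open>w\<close>, since
    \<open>w^T z = w^T C w\<close>.\<close>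
  have wz: "(\<Sum>a<n. w a * z a) = 0"
    using iso by (simp add: z_def sum_distrib_left mult_ac)

  \<comment> \<open>The block matrix for H[G] and its inverse\<close>
  define M :: "nat \<Rightarrow> nat \<Rightarrow> real" where "M u v = (if (g u, g v) \<in> parcs H then 1 else 0)" for u v
  have M_sym: "M u v = M v u" for u v
    using H.pair_sym_arcs by (auto simp: M_def symmetric_def dest: symD)
  have M_diag: "M u u = 0" for u
    using H.pair_no_loops by (fastforce simp: M_def)
  define B where "B = mat (m * n) (m * n) (\<lambda>(k, l).
    (if k div n = l div n then A $$ (k mod n, l mod n) else 0)
      + M (k div n) (l div n) * w (k mod n) * w (l mod n))"
  define D where "D = mat (m * n) (m * n) (\<lambda>(k, l).
    (if k div n = l div n then C $$ (k mod n, l mod n) else 0)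
      - M (k div n) (l div n) * z (k mod n) * z (l mod n))"
  have B: "B \<in> carrier_mat (m * n) (m * n)" and D: "D \<in> carrier_mat (m * n) (m * n)"
    by (simp_all add: B_def D_def)
  note ranges = less_mult_imp_div_less mod_less_of_less_mult
  have BD: "B * D = 1\<^sub>m (m * n)"
    unfolding mat_mult_eq_one_iff[OF B D]
  proof (intro allI impI)
    fix k l assume kl: "k < m * n" "l < m * n"
    let ?u = "k div n" and ?x = "k mod n" and ?v = "l div n" and ?y = "l mod n"
    have "(\<Sum>i<m * n. B $$ (k, i) * D $$ (i, l)) = (\<Sum>i<m * n.
        ((if ?u = i div n then A $$ (?x, i mod n) else 0) + M ?u (i div n) * w ?x * w (i mod n)) *
        ((if i div n = ?v then C $$ (i mod n, ?y) else 0) - M (i div n) ?v * z (i mod n) * z ?y))"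
      using kl by (intro sum.cong) (simp_all add: B_def D_def)
    also have "\<dots> = (\<Sum>s<m. \<Sum>a<n.
        ((if ?u = s then A $$ (?x, a) else 0) + M ?u s * w ?x * w a) *
        ((if s = ?v then C $$ (a, ?y) else 0) - M s ?v * z a * z ?y))"
      by (rule sum_div_mod)
    also have "\<dots> = (if ?u = ?v \<and> ?x = ?y then 1 else 0)"
      using AC' Az wC wz kl by (intro sum_kronecker_block_product) (simp_all add: ranges)
    also have "\<dots> = (if k = l then 1 else 0)"
      by (metis div_mult_mod_eq)
    finally show "(\<Sum>i<m * n. B $$ (k, i) * D $$ (i, l)) = (if k = l then 1 else 0)" .
  qed
  \<comment> \<open>The correction term vanishes on the diagonal because H has no loops.\<close>
  have D_diag: "\<forall>k<m * n. D $$ (k, k) = 0"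
    using C_diag by (auto simp: D_def M_diag ranges)

  \<comment> \<open>The pattern of the block matrix\<close>
  have "B \<in> graph_matrices (\<lambda>k. (g (k div n), f (k mod n))) ?L"
    unfolding graph_matrices_def card_L
  proof (intro CollectI conjI allI impI)
    show "B \<in> carrier_mat (m * n) (m * n)" by (rule B)
    show "transpose_mat B = B"
      by (rule eq_matI) (auto simp: B_def A_sym' ranges M_sym)
    fix k l assume kl: "k < m * n" "l < m * n" "k \<noteq> l"
    let ?u = "k div n" and ?x = "k mod n" and ?v = "l div n" and ?y = "l mod n"
    have "g ` {0..<m} = pverts H" "inj_on g {0..<m}" "f ` {0..<n} = pverts G"
      using f g by (auto simp: vertex_enum_def bij_betw_def m_def n_def)
    then have verts: "g ?u \<in> pverts H" "g ?v \<in> pverts H" "f ?x \<in> pverts G" "f ?y \<in> pverts G"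
      and g_inj: "g ?u = g ?v \<longleftrightarrow> ?u = ?v"
      using kl ranges by (auto simp: inj_on_eq_iff)
    have edge: "((g ?u, f ?x), (g ?v, f ?y)) \<in> parcs ?L \<longleftrightarrow>
        (g ?u, g ?v) \<in> parcs H \<or> ?u = ?v \<and> (f ?x, f ?y) \<in> parcs G"
      using verts g_inj by (auto simp: lex_product_def)
    \<comment> \<open>Inside a copy \<open>M\<close> vanishes and the entry is that of
      \<open>A\<close>. Between distinct copies it is \<open>M\<close> times two entries of
      \<open>w\<close>; these are nonzero, so adjacent copies are completely joined.\<close>
    show "B $$ (k, l) \<noteq> 0 \<longleftrightarrow> ((g ?u, f ?x), (g ?v, f ?y)) \<in> parcs ?L"
    proof (cases "?u = ?v")
      case True
      then have "?x \<noteq> ?y" using kl(3) by (metis div_mult_mod_eq)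
      moreover have "(g ?u, g ?v) \<notin> parcs H"
        using True M_diag[of ?u] by (simp add: M_def split: if_splits)
      ultimately show ?thesis
        using kl True A_edge[of ?x ?y] edge by (simp add: B_def M_diag ranges)
    next
      case False
      then show ?thesis
        using kl w edge by (simp add: B_def M_def ranges)
    qed
  qed
  moreover have "vertex_enum (\<lambda>k. (g (k div n), f (k mod n))) ?L"
    unfolding n_def by (rule vertex_enum_lex_product[OF g f])
  ultimately show ?thesis
    unfolding property_P_iff card_L using D BD D_diag by blast
qed

end
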